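(* Let $W_1,\dots,W_m\subseteq\mathbb{R}^n$ be nonempty convex sets given by $$W_k=\Big\{x\in\mathbb{R}^n:\ \exists\,u^{(k)}\in\mathbb{R}^{N_k},\ A^{(k)}+\sum_{i=1}^n x_iB_i^{(k)}+\sum_{j=1}^{N_k}u_j^{(k)}C_j^{(k)}\succeq 0\Big\}$$ for some real symmetric matrices $A^{(k)},B_i^{(k)},C_j^{(k)}$ (of the same size for each fixed $k$). Define $$\mathcal{C}=\Big\{\sum_{k=1}^m x^{(k)}:\ x^{(k)}\in\mathbb{R}^n,\ \exists\,\lambda\in\Delta_m,\ \exists\,u^{(k)}\in\mathbb{R}^{N_k},\ \lambda_kA^{(k)}+\sum_{i=1}^n x_i^{(k)}B_i^{(k)}+\sum_{j=1}^{N_k}u_j^{(k)}C_j^{(k)}\succeq 0,\ 1\le k\le m\Big\}.$$ Then $$\mathrm{conv}\Big(\bigcup_{k=1}^m W_k\Big)\subseteq\mathcal{C}\qquad\text{and}\qquad \overline{\mathcal{C}}=\overline{\mathrm{conv}\Big(\bigcup_{k=1}^m W_k\Big)}.$$ In addition, if every $W_k$ is bounded, then $\mathcal{C}=\mathrm{conv}\big(\bigcup_{k=1}^m W_k\big)$.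
   Context: $\Delta_m=\{\lambda\in\mathbb{R}^m:\lambda_k\ge 0,\ \lambda_1+\cdots+\lambda_m=1\}$ is the standard simplex. $X\succeq 0$ means the symmetric matrix $X$ is positive semidefinite. $\overline{W}$ is the closure of $W$ and $\mathrm{conv}$ denotes convex hull. *)

theory Defs
  imports "HOL-Analysis.Analysis" "Jordan_Normal_Form.Matrix"
begin

(* The matrix sizes and the numbers N_k of lifting variables vary with k, so matrices and the
   vectors u, lambda are the dimension-carrying ones of Jordan_Normal_Form; only the ambient
   space R^n is a type, real^'n. The names mat and vec also exist in HOL-Analysis and are
   qualified for that reason. Indices k, j and matrix entries are counted from 0. *)

definition std_simplex :: "nat \<Rightarrow> real Matrix.vec set" where
  "std_simplex m =
     {l \<in> carrier_vec m. (\<forall>k<m. 0 \<le> vec_index l k) \<and> (\<Sum>k<m. vec_index l k) = 1}"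

definition sym_mat :: "real Matrix.mat \<Rightarrow> bool" where
  "sym_mat M \<longleftrightarrow> transpose_mat M = M"

definition psd :: "real Matrix.mat \<Rightarrow> bool" where
  "psd M \<longleftrightarrow> sym_mat M \<and> (\<forall>v \<in> carrier_vec (dim_row M). 0 \<le> scalar_prod v (mult_mat_vec M v))"

(* A + sum_i x_i B_i + sum_j u_j C_j, written entrywise because matrices without a fixed
   size have no zero and hence no sum over finite sets. Meaningful when all B_i, C_j have the
   size of A; j ranges over the coordinates of u. *)
definition pencil ::
  "real Matrix.mat \<Rightarrow> ('n::finite \<Rightarrow> real Matrix.mat) \<Rightarrow> (nat \<Rightarrow> real Matrix.mat)
    \<Rightarrow> real^'n \<Rightarrow> real Matrix.vec \<Rightarrow> real Matrix.mat" where
  "pencil A B C x u = Matrix.mat (dim_row A) (dim_col A) (\<lambda>(r, s).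
     A $$ (r, s) + (\<Sum>i\<in>UNIV. vec_nth x i * B i $$ (r, s))
       + (\<Sum>j<dim_vec u. vec_index u j * C j $$ (r, s)))"

definition sdp_set ::
  "nat \<Rightarrow> real Matrix.mat \<Rightarrow> ('n::finite \<Rightarrow> real Matrix.mat) \<Rightarrow> (nat \<Rightarrow> real Matrix.mat)
    \<Rightarrow> (real^'n) set" where
  "sdp_set N A B C = {x. \<exists>u \<in> carrier_vec N. psd (pencil A B C x u)}"

definition conv_lift ::
  "nat \<Rightarrow> (nat \<Rightarrow> nat) \<Rightarrow> (nat \<Rightarrow> real Matrix.mat) \<Rightarrow> (nat \<Rightarrow> 'n::finite \<Rightarrow> real Matrix.mat)
    \<Rightarrow> (nat \<Rightarrow> nat \<Rightarrow> real Matrix.mat) \<Rightarrow> (real^'n) set" where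
  "conv_lift m N A B C =
     {\<Sum>k<m. x k | x. \<exists>l \<in> std_simplex m. \<exists>u. \<forall>k<m. u k \<in> carrier_vec (N k) \<and>
        psd (pencil (smult_mat (vec_index l k) (A k)) (B k) (C k) (x k) (u k))}"

end

(* With each W_k associate the convex cone K_k of all pairs (t, x) for which t A + sum x_i B_i +
   sum u_j C_j is positive semidefinite for some u, so that W_k is the slice of K_k at t = 1 and
   the lifted set consists of the sums of x_k with (l_k, x_k) in K_k and l in the simplex. Scaling
   identifies the points with all l_k > 0 with convex combinations, and sliding an arbitrary point
   towards such a point shows that it is a limit of convex combinations. An entry (0, x) of K_k
   makes x a direction of recession of W_k, hence x = 0 when W_k is bounded. *)
theory Submission
  imports Defs
begin

section \<open>Slices of convex cones\<close>

definition cone_slice :: "(real \<times> 'a::real_vector) set \<Rightarrow> real \<Rightarrow> 'a set" where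
  "cone_slice K t = {x. (t, x) \<in> K}"

text \<open>The lifted set for abstract cones. Each weight is the height of a slice and each
  \<open>x i\<close> already carries it as a factor, so nothing is divided by a weight that may
  vanish; at weight 0 a summand can be any element of the slice at height 0.\<close>

definition simplex_sum :: "'i set \<Rightarrow> ('i \<Rightarrow> (real \<times> 'a::real_vector) set) \<Rightarrow> 'a set" where
  "simplex_sum I K = {\<Sum>i\<in>I. x i | c x.
     (\<forall>i\<in>I. 0 \<le> c i) \<and> sum c I = 1 \<and> (\<forall>i\<in>I. x i \<in> cone_slice (K i) (c i))}"

lemma cone_slice_scaleR:
  assumes "convex_cone K" "x \<in> cone_slice K t" "0 \<le> c"
  shows "c *\<^sub>R x \<in> cone_slice K (c * t)"
  using convex_cone_scaleR[OF assms(1,3), of "(t, x)"] assms(2) by (simp add: cone_slice_def)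

lemma cone_slice_add:
  assumes "convex_cone K" "x \<in> cone_slice K s" "y \<in> cone_slice K t"
  shows "x + y \<in> cone_slice K (s + t)"
  using convex_cone_add[OF assms(1), of "(s, x)" "(t, y)"] assms(2,3) by (simp add: cone_slice_def)

lemma cone_slice_pos:
  assumes "convex_cone K" "x \<in> cone_slice K t" "0 < t"
  shows "x /\<^sub>R t \<in> cone_slice K 1"
  using cone_slice_scaleR[OF assms(1,2), of "inverse t"] assms(3) by simp

lemma convex_cone_slice:
  assumes "convex_cone K"
  shows "convex (cone_slice K t)"
proof (rule convexI)
  fix x y and u v :: real
  assume xy: "x \<in> cone_slice K t" "y \<in> cone_slice K t" and uv: "0 \<le> u" "0 \<le> v" "u + v = 1"
  have "u *\<^sub>R x + v *\<^sub>R y \<in> cone_slice K (u * t + v * t)"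
    using assms xy uv by (intro cone_slice_add cone_slice_scaleR)
  moreover have "u * t + v * t = t"
    using uv(3) by (metis distrib_right mult_1)
  ultimately show "u *\<^sub>R x + v *\<^sub>R y \<in> cone_slice K t"
    by simp
qed

text \<open>Adding a nonnegative multiple of \<open>x\<close> to \<open>w\<close> does not change
  the height, so the slice at height 1 contains the whole ray from \<open>w\<close> in direction
  \<open>x\<close>.\<close>

lemma bounded_slice_zero:
  fixes K :: "(real \<times> 'a::real_normed_vector) set"
  assumes K: "convex_cone K" and b: "bounded (cone_slice K 1)"
    and w: "w \<in> cone_slice K 1" and x: "x \<in> cone_slice K 0"
  shows "x = 0"
proof (rule ccontr)
  assume "x \<noteq> 0"
  obtain B where B: "\<And>z. z \<in> cone_slice K 1 \<Longrightarrow> norm z \<le> B"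
    using b by (auto simp: bounded_iff)
  have B0: "0 \<le> B"
    using B[OF w] norm_ge_zero[of w] by linarith
  \<comment> \<open>Chosen so that \<open>t *\<^sub>R x\<close> is longer by 1 than the bound
    \<open>B + norm w\<close> that the triangle inequality will impose on it.\<close>
  define t where "t = (B + norm w + 1) / norm x"
  have t: "0 \<le> t" "t * norm x = B + norm w + 1"
    using \<open>x \<noteq> 0\<close> B0 by (simp_all add: t_def)
  have "w + t *\<^sub>R x \<in> cone_slice K 1"
    using cone_slice_add[OF K w cone_slice_scaleR[OF K x t(1)]] by simp
  then have "norm (w + t *\<^sub>R x) \<le> B"
    by (rule B)
  moreover have "norm (t *\<^sub>R x) \<le> norm (w + t *\<^sub>R x) + norm w"
    using norm_triangle_ineq4[of "w + t *\<^sub>R x" w] by simp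
  ultimately show False
    using t by simp
qed

text \<open>Since the slices are convex and nonempty, all points taken from one slice merge into a
  single point, and an index of weight 0 can still be given one.\<close>

lemma hull_slices:
  assumes "finite I" "\<And>i. i \<in> I \<Longrightarrow> convex_cone (K i)"
    "\<And>i. i \<in> I \<Longrightarrow> cone_slice (K i) 1 \<noteq> {}"
  shows "convex hull (\<Union>i\<in>I. cone_slice (K i) 1) = {\<Sum>i\<in>I. c i *\<^sub>R x i | c x.
     (\<forall>i\<in>I. 0 \<le> c i) \<and> sum c I = 1 \<and> (\<forall>i\<in>I. x i \<in> cone_slice (K i) 1)}"
  using assms by (intro convex_hull_finite_union) (auto intro: convex_cone_slice)

lemma hull_slices_subset_simplex_sum:
  assumes "finite I" and K: "\<And>i. i \<in> I \<Longrightarrow> convex_cone (K i)"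
    and "\<And>i. i \<in> I \<Longrightarrow> cone_slice (K i) 1 \<noteq> {}"
  shows "convex hull (\<Union>i\<in>I. cone_slice (K i) 1) \<subseteq> simplex_sum I K"
proof
  fix y assume "y \<in> convex hull (\<Union>i\<in>I. cone_slice (K i) 1)"
  then obtain c x where y: "y = (\<Sum>i\<in>I. c i *\<^sub>R x i)" and c: "\<forall>i\<in>I. 0 \<le> c i" "sum c I = 1"
    and x: "\<forall>i\<in>I. x i \<in> cone_slice (K i) 1"
    using hull_slices[of I K, OF assms] by auto
  have "\<forall>i\<in>I. c i *\<^sub>R x i \<in> cone_slice (K i) (c i)"
    using cone_slice_scaleR[OF K] x c by force
  then show "y \<in> simplex_sum I K"
    unfolding simplex_sum_def using y c by blast
qed

lemma positive_sum_in_hull_slices: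
  assumes "finite I" and K: "\<And>i. i \<in> I \<Longrightarrow> convex_cone (K i)"
    and ne: "\<And>i. i \<in> I \<Longrightarrow> cone_slice (K i) 1 \<noteq> {}"
    and c: "\<And>i. i \<in> I \<Longrightarrow> 0 \<le> c i" "sum c I = 1"
    and x: "\<And>i. i \<in> I \<Longrightarrow> x i \<in> cone_slice (K i) (c i)"
    and zero: "\<And>i. i \<in> I \<Longrightarrow> c i = 0 \<Longrightarrow> x i = 0"
  shows "(\<Sum>i\<in>I. x i) \<in> convex hull (\<Union>i\<in>I. cone_slice (K i) 1)"
proof -
  \<comment> \<open>At weight 0 any point of the nonempty slice will do, because its coefficient in
    the convex combination is 0.\<close>
  define z where "z i = (if c i = 0 then (SOME w. w \<in> cone_slice (K i) 1) else x i /\<^sub>R c i)" for i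
  have "z i \<in> cone_slice (K i) 1" if "i \<in> I" for i
    using cone_slice_pos[OF K[OF that] x[OF that]] ne[OF that] c(1)[OF that]
    by (auto simp: z_def some_in_eq)
  moreover have "(\<Sum>i\<in>I. x i) = (\<Sum>i\<in>I. c i *\<^sub>R z i)"
    using zero by (intro sum.cong) (auto simp: z_def)
  ultimately show ?thesis
    using c by (subst hull_slices[of I K, OF assms(1-3)]) blast+
qed

text \<open>Moving slightly towards an average of points of all the slices makes every weight
  positive, which lands in the convex hull; the moved points converge back to the given one.\<close>

lemma simplex_sum_subset_closure:
  fixes K :: "'i \<Rightarrow> (real \<times> 'a::real_normed_vector) set"
  assumes "finite I" and K: "\<And>i. i \<in> I \<Longrightarrow> convex_cone (K i)"
    and ne: "\<And>i. i \<in> I \<Longrightarrow> cone_slice (K i) 1 \<noteq> {}"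
  shows "simplex_sum I K \<subseteq> closure (convex hull (\<Union>i\<in>I. cone_slice (K i) 1))"
    (is "_ \<subseteq> closure ?H")
proof
  fix y assume "y \<in> simplex_sum I K"
  then obtain c x where y: "y = (\<Sum>i\<in>I. x i)" and c: "\<forall>i\<in>I. 0 \<le> c i" "sum c I = 1"
    and x: "\<forall>i\<in>I. x i \<in> cone_slice (K i) (c i)"
    unfolding simplex_sum_def by blast
  obtain w where w: "\<forall>i\<in>I. w i \<in> cone_slice (K i) 1"
    using bchoice[of I "\<lambda>i z. z \<in> cone_slice (K i) 1"] ne by blast
  \<comment> \<open>The uniform weight, which makes \<open>p\<close> below the average of the points
    \<open>w i\<close>.\<close>
  define a where "a = inverse (real (card I))"
  have "I \<noteq> {}"
    using c(2) by auto
  then have a: "0 < a" "card I * a = 1"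
    using assms(1) by (simp_all add: a_def card_gt_0_iff)
  define p where "p = (\<Sum>i\<in>I. a *\<^sub>R w i)"
  have *: "(1 - e) *\<^sub>R y + e *\<^sub>R p \<in> ?H" if e: "0 < e" "e < 1" for e
  proof -
    have "(\<Sum>i\<in>I. (1 - e) *\<^sub>R x i + e *\<^sub>R a *\<^sub>R w i) \<in> ?H"
    proof (rule positive_sum_in_hull_slices[where c = "\<lambda>i. (1 - e) * c i + e * a"])
      show "(\<Sum>i\<in>I. (1 - e) * c i + e * a) = 1"
        using c(2) a(2) by (simp add: sum.distrib flip: sum_distrib_left)
    next
      fix i assume i: "i \<in> I"
      have "a *\<^sub>R w i \<in> cone_slice (K i) a"
        using cone_slice_scaleR[OF K[OF i], of "w i" 1 a] w i a by simp
      then show "(1 - e) *\<^sub>R x i + e *\<^sub>R a *\<^sub>R w i \<in> cone_slice (K i) ((1 - e) * c i + e * a)"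
        using K i x e by (intro cone_slice_add cone_slice_scaleR) auto
      \<comment> \<open>The term \<open>e * a\<close> is positive even if \<open>c i\<close>
        vanishes, so the condition on indices of weight zero holds vacuously.\<close>
      have pos: "0 < (1 - e) * c i + e * a"
        using c i e a by (intro add_nonneg_pos) auto
      show "0 \<le> (1 - e) * c i + e * a"
        using pos by simp
      show "(1 - e) *\<^sub>R x i + e *\<^sub>R a *\<^sub>R w i = 0" if "(1 - e) * c i + e * a = 0"
        using pos that by simp
    qed (use assms in auto)
    then show ?thesis
      by (simp add: y p_def sum.distrib scaleR_sum_right)
  qed
  \<comment> \<open>The limit is taken from the right because membership in the hull is known only
    for \<open>e\<close> strictly between 0 and 1.\<close>
  have "((\<lambda>e. (1 - e) *\<^sub>R y + e *\<^sub>R p) \<longlongrightarrow> (1 - 0) *\<^sub>R y + 0 *\<^sub>R p) (at_right 0)"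
    by (intro tendsto_intros)
  moreover have "\<forall>\<^sub>F e in at_right (0::real). (1 - e) *\<^sub>R y + e *\<^sub>R p \<in> closure ?H"
    using * closure_subset by (intro eventually_at_rightI[of 0 1]) auto
  ultimately show "y \<in> closure ?H"
    using Lim_in_closed_set[OF closed_closure] by force
qed

lemma simplex_sum_eq_hull_slices:
  fixes K :: "'i \<Rightarrow> (real \<times> 'a::real_normed_vector) set"
  assumes "finite I" and K: "\<And>i. i \<in> I \<Longrightarrow> convex_cone (K i)"
    and ne: "\<And>i. i \<in> I \<Longrightarrow> cone_slice (K i) 1 \<noteq> {}"
    and b: "\<And>i. i \<in> I \<Longrightarrow> bounded (cone_slice (K i) 1)"
  shows "simplex_sum I K = convex hull (\<Union>i\<in>I. cone_slice (K i) 1)"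
proof
  show "simplex_sum I K \<subseteq> convex hull (\<Union>i\<in>I. cone_slice (K i) 1)"
  proof
    fix y assume "y \<in> simplex_sum I K"
    then obtain c x where y: "y = (\<Sum>i\<in>I. x i)" and c: "\<forall>i\<in>I. 0 \<le> c i" "sum c I = 1"
      and x: "\<forall>i\<in>I. x i \<in> cone_slice (K i) (c i)"
      unfolding simplex_sum_def by blast
    show "y \<in> convex hull (\<Union>i\<in>I. cone_slice (K i) 1)"
      unfolding y
    proof (rule positive_sum_in_hull_slices[where c = c])
      fix i assume i: "i \<in> I" and "c i = 0"
      then show "x i = 0"
        using bounded_slice_zero[OF K[OF i] b[OF i]] ne[OF i] x by force
    qed (use assms c x in auto)
  qed
qed (rule hull_slices_subset_simplex_sum[OF assms(1-3)])

section \<open>The cone of a linear matrix inequality\<close>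

lemma psd_zero: "psd (0\<^sub>m d d)"
proof -
  have "0\<^sub>m d d *\<^sub>v v = 0\<^sub>v d" if "v \<in> carrier_vec d" for v :: "real Matrix.vec"
    using that by (intro eq_vecI) auto
  then show ?thesis
    by (simp add: psd_def sym_mat_def)
qed

lemma psd_smult:
  assumes "psd M" "0 \<le> c"
  shows "psd (c \<cdot>\<^sub>m M)"
proof -
  \<comment> \<open>\<open>psd\<close> does not ask for a square matrix explicitly; symmetry forces
    it by comparing the dimensions of the transpose.\<close>
  have sq: "dim_col M = dim_row M"
    using assms(1) unfolding psd_def sym_mat_def by (metis index_transpose_mat(3))
  have "scalar_prod v (c \<cdot>\<^sub>m M *\<^sub>v v) = c * scalar_prod v (M *\<^sub>v v)"
    if "v \<in> carrier_vec (dim_row M)" for v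
  proof -
    have "c \<cdot>\<^sub>m M *\<^sub>v v = c \<cdot>\<^sub>v (M *\<^sub>v v)"
      using that sq by (intro eq_vecI) auto
    then show ?thesis
      using that by simp
  qed
  moreover have "transpose_mat (c \<cdot>\<^sub>m M) = c \<cdot>\<^sub>m transpose_mat M"
    by (intro eq_matI) auto
  ultimately show ?thesis
    using assms by (auto simp: psd_def sym_mat_def)
qed

lemma psd_add:
  assumes "psd M" "psd M'" "M \<in> carrier_mat d d" "M' \<in> carrier_mat d d"
  shows "psd (M + M')"
proof -
  have "scalar_prod v ((M + M') *\<^sub>v v) = scalar_prod v (M *\<^sub>v v) + scalar_prod v (M' *\<^sub>v v)"
    if v: "v \<in> carrier_vec d" for v
    using assms(3,4) v
    by (simp add: add_mult_distrib_mat_vec[of M d d M' v] scalar_prod_add_distrib[of v d])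
  then show ?thesis
    using assms by (auto simp: psd_def sym_mat_def transpose_add[of M d d M'])
qed

text \<open>Scaling \<open>A\<close> alone homogenises the inequality: the pencil becomes linear in
  \<open>t\<close>, \<open>x\<close> and \<open>u\<close> jointly. The sign of \<open>t\<close> is
  left free, as the weights in \<open>simplex_sum\<close> are nonnegative anyway.\<close>

definition lmi_cone ::
  "nat \<Rightarrow> real Matrix.mat \<Rightarrow> ('n::finite \<Rightarrow> real Matrix.mat) \<Rightarrow> (nat \<Rightarrow> real Matrix.mat)
    \<Rightarrow> (real \<times> (real^'n)) set" where
  "lmi_cone N A B C = {(t, x). \<exists>u \<in> carrier_vec N. psd (pencil (t \<cdot>\<^sub>m A) B C x u)}"

lemma pencil_carrier:
  "A \<in> carrier_mat d d \<Longrightarrow> pencil (t \<cdot>\<^sub>m A) B C x u \<in> carrier_mat d d"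
  by (simp add: pencil_def)

lemma pencil_zero:
  "A \<in> carrier_mat d d \<Longrightarrow> pencil (0 \<cdot>\<^sub>m A) B C 0 (0\<^sub>v N) = 0\<^sub>m d d"
  by (intro eq_matI) (auto simp: pencil_def)

text \<open>The common dimension \<open>N\<close> matters because the pencil reads the range of its
  sum over \<open>j\<close> off the vector of lifting variables.\<close>

lemma pencil_add:
  assumes "u \<in> carrier_vec N" "v \<in> carrier_vec N"
  shows "pencil ((s + t) \<cdot>\<^sub>m A) B C (x + y) (u + v)
    = pencil (s \<cdot>\<^sub>m A) B C x u + pencil (t \<cdot>\<^sub>m A) B C y v"
  using assms by (intro eq_matI) (auto simp: pencil_def distrib_right sum.distrib)

lemma pencil_smult:
  "pencil ((c * t) \<cdot>\<^sub>m A) B C (c *\<^sub>R x) (c \<cdot>\<^sub>v u) = c \<cdot>\<^sub>m pencil (t \<cdot>\<^sub>m A) B C x u"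
  by (intro eq_matI) (auto simp: pencil_def distrib_left sum_distrib_left mult.assoc)

text \<open>Positive semidefinite matrices of a fixed size form a convex cone, its preimage under
  the jointly linear pencil is again one, and so is the projection that forgets
  \<open>u\<close>.\<close>

lemma convex_cone_lmi_cone:
  assumes A: "A \<in> carrier_mat d d"
  shows "convex_cone (lmi_cone N A B C)"
  unfolding convex_cone_iff
proof (intro conjI ballI allI impI)
  show "0 \<in> lmi_cone N A B C"
    using pencil_zero[OF A, of B C N] psd_zero[of d]
    by (auto simp: lmi_cone_def zero_prod_def intro!: bexI[of _ "0\<^sub>v N"])
next
  fix p q assume "p \<in> lmi_cone N A B C" "q \<in> lmi_cone N A B C"
  then obtain s x u t y v where p: "p = (s, x)" "u \<in> carrier_vec N" "psd (pencil (s \<cdot>\<^sub>m A) B C x u)"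
    and q: "q = (t, y)" "v \<in> carrier_vec N" "psd (pencil (t \<cdot>\<^sub>m A) B C y v)"
    by (auto simp: lmi_cone_def)
  have "psd (pencil ((s + t) \<cdot>\<^sub>m A) B C (x + y) (u + v))"
    using p q psd_add[OF _ _ pencil_carrier[OF A] pencil_carrier[OF A]] by (simp add: pencil_add)
  then show "p + q \<in> lmi_cone N A B C"
    using p q by (auto simp: lmi_cone_def intro!: bexI[of _ "u + v"])
next
  fix p and c :: real assume "p \<in> lmi_cone N A B C" "0 \<le> c"
  then obtain t x u where p: "p = (t, x)" "u \<in> carrier_vec N" "psd (pencil (t \<cdot>\<^sub>m A) B C x u)"
    by (auto simp: lmi_cone_def)
  have "psd (pencil ((c * t) \<cdot>\<^sub>m A) B C (c *\<^sub>R x) (c \<cdot>\<^sub>v u))"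
    using p \<open>0 \<le> c\<close> by (simp add: pencil_smult psd_smult)
  then show "c *\<^sub>R p \<in> lmi_cone N A B C"
    using p by (auto simp: lmi_cone_def intro!: bexI[of _ "c \<cdot>\<^sub>v u"])
qed

lemma cone_slice_lmi_cone: "cone_slice (lmi_cone N A B C) 1 = sdp_set N A B C"
proof -
  have "1 \<cdot>\<^sub>m A = A"
    by (intro eq_matI) auto
  then show ?thesis
    by (simp add: cone_slice_def lmi_cone_def sdp_set_def)
qed

lemma conv_lift_eq_simplex_sum:
  "conv_lift m N A B C = simplex_sum {..<m} (\<lambda>k. lmi_cone (N k) (A k) (B k) (C k))"
proof (intro equalityI subsetI)
  fix y assume "y \<in> conv_lift m N A B C"
  then obtain x l u where "y = (\<Sum>k<m. x k)" "l \<in> std_simplex m"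
    "\<forall>k<m. u k \<in> carrier_vec (N k) \<and> psd (pencil (vec_index l k \<cdot>\<^sub>m A k) (B k) (C k) (x k) (u k))"
    unfolding conv_lift_def by blast
  then show "y \<in> simplex_sum {..<m} (\<lambda>k. lmi_cone (N k) (A k) (B k) (C k))"
    by (auto simp: simplex_sum_def std_simplex_def cone_slice_def lmi_cone_def
        intro!: exI[of _ "vec_index l"] exI[of _ x])
next
  fix y assume "y \<in> simplex_sum {..<m} (\<lambda>k. lmi_cone (N k) (A k) (B k) (C k))"
  then obtain c x where y: "y = (\<Sum>k<m. x k)" and c: "\<forall>k<m. 0 \<le> c k" "(\<Sum>k<m. c k) = 1"
    and x: "\<forall>k<m. x k \<in> cone_slice (lmi_cone (N k) (A k) (B k) (C k)) (c k)"
    unfolding simplex_sum_def Ball_def lessThan_iff by blast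
  \<comment> \<open>Cone membership gives lifting variables for each \<open>k\<close> separately,
    whereas \<open>conv_lift\<close> asks for one family \<open>u\<close>; choice over
    \<open>k\<close> joins them.\<close>
  have "\<forall>k<m. \<exists>u. u \<in> carrier_vec (N k) \<and> psd (pencil (c k \<cdot>\<^sub>m A k) (B k) (C k) (x k) u)"
    using x by (auto simp: cone_slice_def lmi_cone_def)
  then obtain u where
    u: "\<forall>k<m. u k \<in> carrier_vec (N k) \<and> psd (pencil (c k \<cdot>\<^sub>m A k) (B k) (C k) (x k) (u k))"
    by metis
  have "Matrix.vec m c \<in> std_simplex m"
    using c by (simp add: std_simplex_def)
  then show "y \<in> conv_lift m N A B C"
    unfolding conv_lift_def using y u by (auto intro!: exI[of _ x] bexI[of _ "Matrix.vec m c"])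
qed

theorem theorem2p2:
  fixes m :: nat
    and d N :: "nat \<Rightarrow> nat"
    and A :: "nat \<Rightarrow> real Matrix.mat"
    and B :: "nat \<Rightarrow> 'n::finite \<Rightarrow> real Matrix.mat"
    and C :: "nat \<Rightarrow> nat \<Rightarrow> real Matrix.mat"
    and W :: "nat \<Rightarrow> (real^'n) set"
  assumes A: "\<And>k. k < m \<Longrightarrow> A k \<in> carrier_mat (d k) (d k) \<and> sym_mat (A k)"
    and B: "\<And>k i. k < m \<Longrightarrow> B k i \<in> carrier_mat (d k) (d k) \<and> sym_mat (B k i)"
    and C: "\<And>k j. k < m \<Longrightarrow> j < N k \<Longrightarrow> C k j \<in> carrier_mat (d k) (d k) \<and> sym_mat (C k j)"
    and W: "\<And>k. k < m \<Longrightarrow> W k = sdp_set (N k) (A k) (B k) (C k)"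
    and nonempty: "\<And>k. k < m \<Longrightarrow> W k \<noteq> {}"
    and convex: "\<And>k. k < m \<Longrightarrow> convex (W k)"
  shows "convex hull (\<Union>k<m. W k) \<subseteq> conv_lift m N A B C
    \<and> closure (conv_lift m N A B C) = closure (convex hull (\<Union>k<m. W k))
    \<and> ((\<forall>k<m. bounded (W k)) \<longrightarrow> conv_lift m N A B C = convex hull (\<Union>k<m. W k))"
proof -
  define K where "K k = lmi_cone (N k) (A k) (B k) (C k)" for k
  have K: "convex_cone (K k)" if "k \<in> {..<m}" for k
    unfolding K_def using A that by (intro convex_cone_lmi_cone[of _ "d k"]) auto
  have slice: "cone_slice (K k) 1 = W k" if "k \<in> {..<m}" for k
    using W that by (simp add: K_def cone_slice_lmi_cone)
  have ne: "cone_slice (K k) 1 \<noteq> {}" if "k \<in> {..<m}" for k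
    using nonempty slice that by simp
  have lift: "conv_lift m N A B C = simplex_sum {..<m} K"
    unfolding K_def by (rule conv_lift_eq_simplex_sum)
  have union: "(\<Union>k<m. W k) = (\<Union>k<m. cone_slice (K k) 1)"
    using slice by simp
  have sub: "convex hull (\<Union>k<m. W k) \<subseteq> conv_lift m N A B C"
    unfolding lift union using K ne by (intro hull_slices_subset_simplex_sum) auto
  have "conv_lift m N A B C \<subseteq> closure (convex hull (\<Union>k<m. W k))"
    unfolding lift union using K ne by (intro simplex_sum_subset_closure) auto
  \<comment> \<open>The lifted set lies between the convex hull and its closure, so both closures
    agree.\<close>
  then have "closure (conv_lift m N A B C) = closure (convex hull (\<Union>k<m. W k))"
    using sub by (intro equalityI closure_mono closure_minimal) auto
  moreover have "conv_lift m N A B C = convex hull (\<Union>k<m. W k)" if "\<forall>k<m. bounded (W k)"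
    unfolding lift union using K ne slice that by (intro simplex_sum_eq_hull_slices) auto
  ultimately show ?thesis
    using sub by blast
qed

end
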